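(* For all integers $n\ge k\ge 1$, $$S_{1,\lambda}^{Y}(n,k)=\frac{1}{k}\sum_{j=k-1}^{n-1}\binom{n}{j}(-1)^{n-j-1}S_{1,\lambda}^{Y}(j,k-1)\kappa_{n-j,\lambda}(Y).$$
   Context: $\lambda$ is a fixed nonzero real number. For real $x$: $(x)_{0,\lambda}=1$, $(x)_{n,\lambda}=x(x-\lambda)\cdots(x-(n-1)\lambda)$ for $n\ge1$. The degenerate exponential is $e_{\lambda}^{x}(t)=(1+\lambda t)^{x/\lambda}=\sum_{n\ge0}(x)_{n,\lambda}\frac{t^n}{n!}$. The degenerate logarithm is, for $\mu\ne0$ and $u>0$, $\log_{\mu}(u)=\frac{1}{\mu}(u^{\mu}-1)$; in particular $\log_{-\lambda}(u)=-\frac1\lambda(u^{-\lambda}-1)$. $Y$ is a real random variable whose degenerate moment generating functions exist near the origin: for every nonzero real $\lambda$ there is $r=r(\lambda)>0$ with $E[e_{\lambda}^{Y}(t)]=\sum_{n\ge0}E[(Y)_{n,\lambda}]\frac{t^n}{n!}$ for $|t|<r$. All generating-function identities are power series expansions at $t=0$. The numbers $\kappa_{n,\lambda}(Y)$ are defined by $\log_{-\lambda}\big(E[e_{\lambda}^{Y}(t)]\big)=\sum_{n\ge0}\kappa_{n,\lambda}(Y)\frac{t^n}{n!}$. Probabilistic degenerate Stirling numbers of the first kind: $\frac{1}{k!}\big(\log_{-\lambda}(E[e_{\lambda}^{Y}(t)])\big)^k=\sum_{n\ge k}(-1)^{n-k}S_{1,\lambda}^{Y}(n,k)\frac{t^n}{n!}$,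 $k\ge0$. *)

theory Defs
  imports "HOL-Complex_Analysis.Complex_Analysis" "HOL-Probability.Probability"
begin

definition deg_ffact :: "real \<Rightarrow> real \<Rightarrow> nat \<Rightarrow> real" where
  "deg_ffact l x n = (\<Prod>i<n. x - real i * l)"

(* Only meaningful for 1 + l * t > 0, which holds for all t near 0. *)
definition deg_exp :: "real \<Rightarrow> real \<Rightarrow> real \<Rightarrow> real" where
  "deg_exp l x t = (1 + l * t) powr (x / l)"

definition deg_log :: "real \<Rightarrow> real \<Rightarrow> real" where
  "deg_log m u = (u powr m - 1) / m"

definition deg_mgf :: "'a measure \<Rightarrow> ('a \<Rightarrow> real) \<Rightarrow> real \<Rightarrow> real \<Rightarrow> real" where
  "deg_mgf M Y l t = (LINT \<omega>|M. deg_exp l (Y \<omega>) t)"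

(* a = egf_coeff f is the sequence with f t = (\<Sum>n. a n * t ^ n / fact n) near t = 0;
   see egf_coeff_unique. *)
definition egf_coeff :: "(real \<Rightarrow> real) \<Rightarrow> nat \<Rightarrow> real" where
  "egf_coeff f n = fact n * fps_nth (THE F. f has_fps_expansion F) n"

definition deg_kappa :: "'a measure \<Rightarrow> ('a \<Rightarrow> real) \<Rightarrow> real \<Rightarrow> nat \<Rightarrow> real" where
  "deg_kappa M Y l = egf_coeff (\<lambda>t. deg_log (-l) (deg_mgf M Y l t))"

(* (-1)^(n-k) is its own inverse, so it may be moved from the generating function to the
   coefficient. The paper defines the numbers for n \<ge> k only; for n < k the value is 0
   whenever the moment generating function exists, see deg_stirling1_gf. *)
definition deg_stirling1 :: "'a measure \<Rightarrow> ('a \<Rightarrow> real) \<Rightarrow> real \<Rightarrow> nat \<Rightarrow> nat \<Rightarrow> real" where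
  "deg_stirling1 M Y l n k =
     (-1) ^ (n - k) * egf_coeff (\<lambda>t. 1 / fact k * deg_log (-l) (deg_mgf M Y l t) ^ k) n"

text \<open>
  Well-definedness: under the standing assumption on \<open>Y\<close> (for the given \<open>l\<close>) the coefficient
  sequences above exist and satisfy the generating-function identities defining them.
\<close>

lemma real_zero_fps_expansion:
  fixes H :: "real fps"
  assumes "(\<lambda>_. 0) has_fps_expansion H"
  shows "fps_nth H n = 0"
  using assms
proof (induction n arbitrary: H)
  case 0
  show ?case using has_fps_expansion_imp_0_eq_fps_nth_0[OF 0] by simp
next
  case (Suc n)
  have rad: "fps_conv_radius H > 0" and ev: "eventually (\<lambda>z. eval_fps H z = 0) (nhds 0)"
    using Suc.prems by (auto simp: has_fps_expansion_def)
  have "eventually (\<lambda>z. z \<in> eball 0 (fps_conv_radius H)) (nhds (0 :: real))"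
    using rad by (intro eventually_nhds_in_open) (auto simp: zero_ereal_def)
  moreover have "eventually (\<lambda>z. eventually (\<lambda>z. eval_fps H z = 0) (nhds z)) (nhds 0)"
    using ev by (simp add: eventually_eventually)
  ultimately have "eventually (\<lambda>z. eval_fps (fps_deriv H) z = 0) (nhds 0)"
  proof eventually_elim
    case (elim z)
    have "eval_fps (fps_deriv H) z = deriv (eval_fps H) z"
      using elim(1) by (intro eval_fps_deriv) simp
    also have "\<dots> = deriv (\<lambda>_. 0) z"
      by (intro deriv_cong_ev elim(2) refl)
    finally show ?case by simp
  qed
  moreover have "fps_conv_radius (fps_deriv H) > 0"
    using rad fps_conv_radius_deriv[of H] by (rule less_le_trans)
  ultimately have "(\<lambda>_. 0) has_fps_expansion fps_deriv H"
    by (simp add: has_fps_expansion_def)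
  from Suc.IH[OF this] show ?case by simp
qed

lemma egf_coeff_eq:
  assumes "f has_fps_expansion F"
  shows "egf_coeff f n = fact n * fps_nth F n"
proof -
  have "F' = F" if "f has_fps_expansion F'" for F'
    using real_zero_fps_expansion[of "F' - F"] has_fps_expansion_diff[OF that assms]
    by (simp add: fps_eq_iff)
  with assms have "(THE F. f has_fps_expansion F) = F" by blast
  thus ?thesis by (simp add: egf_coeff_def)
qed

lemma egf_coeff_unique:
  assumes "eventually (\<lambda>t. (\<lambda>n. a n * t ^ n / fact n) sums f t) (nhds 0)"
  shows "egf_coeff f = a"
proof -
  have "f has_fps_expansion Abs_fps (\<lambda>n. a n / fact n)"
    by (rule has_fps_expansionI) (use assms in \<open>simp add: field_simps\<close>)
  thus ?thesis by (simp add: egf_coeff_eq fun_eq_iff)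
qed

lemma egf_coeff_sums:
  assumes "f has_fps_expansion F"
  shows "eventually (\<lambda>t. (\<lambda>n. egf_coeff f n * t ^ n / fact n) sums f t) (nhds 0)"
proof -
  have "eventually (\<lambda>t. t \<in> eball 0 (fps_conv_radius F)) (nhds (0 :: real))"
    using assms by (intro eventually_nhds_in_open)
      (auto simp: has_fps_expansion_def zero_ereal_def)
  moreover have "eventually (\<lambda>t. eval_fps F t = f t) (nhds 0)"
    using assms by (simp add: has_fps_expansion_def)
  ultimately show ?thesis
  proof eventually_elim
    case (elim t)
    thus ?case using sums_eval_fps[of t F] by (simp add: egf_coeff_eq[OF assms])
  qed
qed

lemma deg_mgf_0: "prob_space M \<Longrightarrow> deg_mgf M Y l 0 = 1"
  by (simp add: deg_mgf_def deg_exp_def prob_space.prob_space)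

lemma deg_log_mgf_has_fps_expansion:
  assumes "prob_space M" "l \<noteq> 0" "r > 0"
    and sums: "\<And>t. \<bar>t\<bar> < r \<Longrightarrow> (\<lambda>n. m n * t ^ n / fact n) sums deg_mgf M Y l t"
  obtains F where "(\<lambda>t. deg_log (-l) (deg_mgf M Y l t)) has_fps_expansion F" "fps_nth F 0 = 0"
proof -
  define G where "G = Abs_fps (\<lambda>n. complex_of_real (m n / fact n))"
  have ev: "eventually (\<lambda>t::real. \<bar>t\<bar> < r) (nhds 0)"
    using eventually_nhds_in_open[of "ball (0::real) r" 0] \<open>r > 0\<close> by simp
  have gG: "(\<lambda>n. fps_nth G n * of_real t ^ n) sums of_real (deg_mgf M Y l t)"
    if "\<bar>t\<bar> < r" for t
    using sums_of_real[OF sums[OF that], where 'a = complex] by (simp add: G_def)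
  have rad: "fps_conv_radius G > 0"
  proof -
    have "ereal (norm (complex_of_real (r / 2))) \<le> fps_conv_radius G"
      unfolding fps_conv_radius_def
      by (rule conv_radius_geI, rule sums_summable, rule gG) (use \<open>r > 0\<close> in auto)
    moreover have "ereal (norm (complex_of_real (r / 2))) > 0" using \<open>r > 0\<close> by simp
    ultimately show ?thesis by (rule less_le_trans[rotated])
  qed
  have G: "eval_fps G (of_real t) = of_real (deg_mgf M Y l t)" if "\<bar>t\<bar> < r" for t
    using gG[OF that] by (simp add: eval_fps_def sums_iff)
  have G0: "eval_fps G 0 = 1"
    using G[of 0] \<open>r > 0\<close> deg_mgf_0[OF \<open>prob_space M\<close>] by simp
  define h where "h = (\<lambda>z. (eval_fps G z powr of_real (-l) - 1) / of_real (-l))"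
  have "eval_fps G analytic_on {0}"
    using eval_fps_has_fps_expansion[OF rad] has_fps_expansion_imp_analytic_0 by blast
  hence "h analytic_on {0}"
    unfolding h_def using G0 \<open>l \<noteq> 0\<close> by (intro analytic_intros) (auto simp: complex_nonpos_Reals_iff rad[unfolded zero_ereal_def])
  then obtain H where H: "h has_fps_expansion H"
    using analytic_at_imp_has_fps_expansion_0 by blast
  have evH: "eventually (\<lambda>z. (\<lambda>n. fps_nth H n * z ^ n) sums h z) (nhds 0)"
  proof -
    have "eventually (\<lambda>z. z \<in> eball 0 (fps_conv_radius H)) (nhds (0 :: complex))"
      using H by (intro eventually_nhds_in_open) (auto simp: has_fps_expansion_def zero_ereal_def)
    moreover have "eventually (\<lambda>z. eval_fps H z = h z) (nhds 0)"
      using H by (simp add: has_fps_expansion_def)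
    ultimately show ?thesis
      by eventually_elim (metis in_eball_iff sums_eval_fps dist_0_norm)
  qed
  have tends: "filterlim complex_of_real (nhds 0) (nhds 0)"
    using tendsto_of_real[OF filterlim_ident[of "nhds (0::real)"], where 'a = complex] by simp
  have "isCont (eval_fps G) 0" using rad
    by (intro continuous_eval_fps) (auto simp: zero_ereal_def)
  hence "filterlim (eval_fps G) (nhds 1) (nhds 0)"
    using G0 by (simp add: isCont_def tendsto_nhds_iff)
  hence "filterlim (\<lambda>t. Re (eval_fps G (of_real t))) (nhds 1) (nhds (0::real))"
    using tendsto_Re[OF filterlim_compose[OF _ tends]] by fastforce
  hence evpos: "eventually (\<lambda>t::real. Re (eval_fps G (of_real t)) > 0) (nhds 0)"
    by (rule order_tendstoD) simp
  define F where "F = Abs_fps (\<lambda>n. Re (fps_nth H n))"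
  have F: "(\<lambda>t. deg_log (-l) (deg_mgf M Y l t)) has_fps_expansion F"
  proof (rule has_fps_expansionI)
    show "eventually (\<lambda>t. (\<lambda>n. fps_nth F n * t ^ n) sums deg_log (-l) (deg_mgf M Y l t)) (nhds 0)"
      using eventually_compose_filterlim[OF evH tends] ev evpos
    proof eventually_elim
      case (elim t)
      have "h (of_real t) = of_real (deg_log (-l) (deg_mgf M Y l t))"
        using elim(3) G[OF elim(2)] powr_of_real[of "deg_mgf M Y l t" "-l"]
        by (simp add: h_def deg_log_def)
      with sums_Re[OF elim(1)] show ?case
        by (simp add: F_def flip: of_real_power)
    qed
  qed
  moreover have "fps_nth F 0 = 0"
    using has_fps_expansion_imp_0_eq_fps_nth_0[OF F] deg_mgf_0[OF \<open>prob_space M\<close>, of Y l]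
    by (simp add: deg_log_def)
  ultimately show ?thesis using that by blast
qed

lemma deg_kappa_gf:
  assumes "prob_space M" "l \<noteq> 0" "r > 0"
    and "\<And>t. \<bar>t\<bar> < r \<Longrightarrow> (\<lambda>n. m n * t ^ n / fact n) sums deg_mgf M Y l t"
  shows "eventually (\<lambda>t. (\<lambda>n. deg_kappa M Y l n * t ^ n / fact n) sums
           deg_log (-l) (deg_mgf M Y l t)) (nhds 0)"
  using deg_log_mgf_has_fps_expansion[OF assms] egf_coeff_sums unfolding deg_kappa_def by metis

lemma deg_stirling1_gf:
  assumes "prob_space M" "l \<noteq> 0" "r > 0"
    and "\<And>t. \<bar>t\<bar> < r \<Longrightarrow> (\<lambda>n. m n * t ^ n / fact n) sums deg_mgf M Y l t"
  shows "eventually (\<lambda>t. (\<lambda>n. (-1) ^ (n - k) * deg_stirling1 M Y l n k * t ^ n / fact n) sums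
           (1 / fact k * deg_log (-l) (deg_mgf M Y l t) ^ k)) (nhds 0)"
    and "n < k \<Longrightarrow> deg_stirling1 M Y l n k = 0"
proof -
  obtain F where F: "(\<lambda>t. deg_log (-l) (deg_mgf M Y l t)) has_fps_expansion F" "fps_nth F 0 = 0"
    using deg_log_mgf_has_fps_expansion[OF assms] by blast
  have Fk: "(\<lambda>t. 1 / fact k * deg_log (-l) (deg_mgf M Y l t) ^ k) has_fps_expansion
          fps_const (1 / fact k) * F ^ k"
    by (intro fps_expansion_intros F)
  have "(-1) ^ (n - k) * deg_stirling1 M Y l n k =
          egf_coeff (\<lambda>t. 1 / fact k * deg_log (-l) (deg_mgf M Y l t) ^ k) n" for n
    by (simp add: deg_stirling1_def flip: mult.assoc power_add power_mult_distrib)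
  with egf_coeff_sums[OF Fk]
  show "eventually (\<lambda>t. (\<lambda>n. (-1) ^ (n - k) * deg_stirling1 M Y l n k * t ^ n / fact n) sums
           (1 / fact k * deg_log (-l) (deg_mgf M Y l t) ^ k)) (nhds 0)"
    by simp
  show "deg_stirling1 M Y l n k = 0" if "n < k"
    unfolding deg_stirling1_def egf_coeff_eq[OF Fk]
    using startsby_zero_power_prefix[OF F(2)] that by simp
qed

end

theory Submission
  imports Defs
begin

text \<open>Let \<open>L\<close> be the degenerate logarithm of the moment generating function and
  \<open>S i\<close> = L^i / i!. Since k! = k * (k-1)!, \<open>S k\<close> is 1/k times the product
  of \<open>S (k - 1)\<close> and \<open>L\<close>. Multiplying exponential generating functions is
  binomial convolution of coefficients (\<open>egf_coeff_mult\<close>), which gives the recurrence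
  as a sum over all j from 0 to n. Because E[e^Y(0)] = 1, \<open>L\<close> vanishes at 0: hence
  \<open>S (k - 1)\<close> has no terms below order k-1, and the zeroth coefficient of
  \<open>L\<close> is 0, so only j from k-1 to n-1 survive. The signs then match term by
  term.\<close>

lemma egf_coeff_mult:
  assumes "f has_fps_expansion F" "g has_fps_expansion G"
  shows "egf_coeff (\<lambda>t. f t * g t) n =
    (\<Sum>j\<le>n. real (n choose j) * egf_coeff f j * egf_coeff g (n - j))"
proof -
  have "egf_coeff (\<lambda>t. f t * g t) n = (\<Sum>j\<le>n. fact n * (fps_nth F j * fps_nth G (n - j)))"
    by (simp add: egf_coeff_eq[OF has_fps_expansion_mult[OF assms]] fps_mult_nth
        sum_distrib_left atLeast0AtMost)
  also have "\<dots> = (\<Sum>j\<le>n. real (n choose j) * egf_coeff f j * egf_coeff g (n - j))"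
    by (rule sum.cong)
      (simp_all add: egf_coeff_eq[OF assms(1)] egf_coeff_eq[OF assms(2)] binomial_fact field_simps)
  finally show ?thesis .
qed

theorem theorem2p7:
  fixes M :: "'a measure" and Y :: "'a \<Rightarrow> real" and l :: real and n k :: nat
  assumes "prob_space M"
    and "Y \<in> borel_measurable M"
    and "\<And>m::real. m \<noteq> 0 \<Longrightarrow>
           \<exists>r>0. (\<forall>j. integrable M (\<lambda>\<omega>. deg_ffact m (Y \<omega>) j)) \<and>
             (\<forall>t. \<bar>t\<bar> < r \<longrightarrow>
                integrable M (\<lambda>\<omega>. deg_exp m (Y \<omega>) t) \<and>
                (\<lambda>j. (LINT \<omega>|M. deg_ffact m (Y \<omega>) j) * t ^ j / fact j) sums deg_mgf M Y m t)"
    and "l \<noteq> 0"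
    and "1 \<le> k" "k \<le> n"
  shows "deg_stirling1 M Y l n k =
    1 / real k * (\<Sum>j = k - 1..n - 1. real (n choose j) * (-1) ^ (n - j - 1) *
      deg_stirling1 M Y l j (k - 1) * deg_kappa M Y l (n - j))"
proof -
  define L where "L = (\<lambda>t. deg_log (-l) (deg_mgf M Y l t))"
  define S where "S = (\<lambda>i t. 1 / fact i * L t ^ i)"
  obtain r where r: "r > 0" and sums: "\<And>t. \<bar>t\<bar> < r \<Longrightarrow>
      (\<lambda>j. (LINT \<omega>|M. deg_ffact l (Y \<omega>) j) * t ^ j / fact j) sums deg_mgf M Y l t"
    using assms(3)[OF \<open>l \<noteq> 0\<close>] by blast
  obtain F where F: "L has_fps_expansion F" and F0: "fps_nth F 0 = 0"
    unfolding L_def using deg_log_mgf_has_fps_expansion[OF assms(1,4) r sums] by blast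
  have S: "S i has_fps_expansion fps_const (1 / fact i) * F ^ i" for i
    unfolding S_def by (intro fps_expansion_intros F)
  have kappa: "deg_kappa M Y l = egf_coeff L"
    by (simp add: deg_kappa_def L_def)
  have stirling: "deg_stirling1 M Y l i j = (-1) ^ (i - j) * egf_coeff (S j) i" for i j
    by (simp add: deg_stirling1_def S_def L_def)
  \<comment> \<open>\<open>F\<close> has zero constant term, so X^i divides
    \<open>F ^ i\<close>.\<close>
  have S_small: "egf_coeff (S i) j = 0" if "j < i" for i j
    using startsby_zero_power_prefix[OF F0] that by (simp add: egf_coeff_eq[OF S])
  have L0: "egf_coeff L 0 = 0"
    by (simp add: egf_coeff_eq[OF F] F0)
  \<comment> \<open>The scalar gets its own expansion so that the product rule can pull it out of
    the coefficient.\<close>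
  have const: "(\<lambda>t. 1 / real k) has_fps_expansion fps_const (1 / real k)"
    by (intro fps_expansion_intros)
  have "S k = (\<lambda>t. 1 / real k * (S (k - 1) t * L t))"
    using \<open>1 \<le> k\<close> by (cases k) (auto simp: S_def fun_eq_iff field_simps)
  hence "egf_coeff (S k) n = 1 / real k * egf_coeff (\<lambda>t. S (k - 1) t * L t) n"
    using egf_coeff_eq[OF has_fps_expansion_mult[OF const has_fps_expansion_mult[OF S F]]]
      egf_coeff_eq[OF has_fps_expansion_mult[OF S F]] by simp
  also have "egf_coeff (\<lambda>t. S (k - 1) t * L t) n =
      (\<Sum>j\<le>n. real (n choose j) * egf_coeff (S (k - 1)) j * egf_coeff L (n - j))"
    by (rule egf_coeff_mult[OF S F])
  also have "\<dots> =
      (\<Sum>j = k - 1..n - 1. real (n choose j) * egf_coeff (S (k - 1)) j * egf_coeff L (n - j))"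
  proof (rule sum.mono_neutral_right)
    show "\<forall>j\<in>{..n} - {k - 1..n - 1}.
        real (n choose j) * egf_coeff (S (k - 1)) j * egf_coeff L (n - j) = 0"
    proof
      fix j assume "j \<in> {..n} - {k - 1..n - 1}"
      \<comment> \<open>The low indices are killed by the order of \<open>S (k - 1)\<close>, the top
        index by \<open>L0\<close>, since there the second factor is coefficient 0 of
        \<open>L\<close>.\<close>
      hence "j < k - 1 \<or> j = n" by auto
      thus "real (n choose j) * egf_coeff (S (k - 1)) j * egf_coeff L (n - j) = 0"
        using S_small L0 by auto
    qed
  qed auto
  finally have "deg_stirling1 M Y l n k = 1 / real k * (\<Sum>j = k - 1..n - 1.
      (-1) ^ (n - k) * (real (n choose j) * egf_coeff (S (k - 1)) j * egf_coeff L (n - j)))"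
    by (simp add: stirling sum_distrib_left)
  also have "(\<Sum>j = k - 1..n - 1.
      (-1) ^ (n - k) * (real (n choose j) * egf_coeff (S (k - 1)) j * egf_coeff L (n - j))) =
    (\<Sum>j = k - 1..n - 1. real (n choose j) * (-1) ^ (n - j - 1) *
      deg_stirling1 M Y l j (k - 1) * deg_kappa M Y l (n - j))"
  proof (rule sum.cong)
    fix j assume "j \<in> {k - 1..n - 1}"
    \<comment> \<open>The global sign splits into the explicit sign of the summand and the sign
      inside \<open>deg_stirling1 M Y l j (k - 1)\<close>. The range of j together with 1 \<le> k
      \<le> n ensures that no natural subtraction here truncates.\<close>
    hence "n - k = (n - j - 1) + (j - (k - 1))" using assms(5,6) by auto
    hence "(-1 :: real) ^ (n - k) = (-1) ^ (n - j - 1) * (-1) ^ (j - (k - 1))"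
      by (simp only: power_add)
    thus "(-1) ^ (n - k) * (real (n choose j) * egf_coeff (S (k - 1)) j * egf_coeff L (n - j)) =
      real (n choose j) * (-1) ^ (n - j - 1) *
        deg_stirling1 M Y l j (k - 1) * deg_kappa M Y l (n - j)"
      by (simp only: stirling kappa mult_ac)
  qed simp
  finally show ?thesis .
qed

end
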